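(* Let $t$ and $m$ be positive integers. Then \[\binom{2m+1}{t(m+1)}_{t} - \binom{2m+1}{t(m+1)+1}_t = \binom{2m+2}{t(m+1)}_t - \binom{2m+2}{t(m+1)+1}_t,\] or equivalently, with $\lambda_j = (j, j-1, \ldots, 1)$ for each positive integer $j$, \[c^{t*\lambda_{2m+1}}_{t*\lambda_{2m},\, t*(m+1, m)} = c^{t*\lambda_{2m+2}}_{t*\lambda_{2m+1},\, t*(m+1, m+1)},\] where $\binom{n}{k}_t$ denotes the $t$-binomial coefficient, $c^{\lambda}_{\mu,\nu}$ denotes the Littlewood-Richardson coefficient, and $t*\lambda$ denotes the partition obtained by multiplying every part of $\lambda$ by $t$. (That is, both identities hold, and the two sides of the first equal the corresponding sides of the second.)
   Context: $t$-binomial coefficients: for positive integers $n, t$ and an integer $k$ with $0\le k\le tn$, $\binom{n}{k}_t$ is the coefficient of $x^k$ in $(1+x+x^2+\cdots+x^t)^n$. Stretching: for a partition $\lambda = (\lambda_1,\lambda_2,\ldots)$, $t*\lambda = (t\lambda_1, t\lambda_2, \ldots)$; e.g. $3*(3,2,1) = (9,6,3)$. Littlewood-Richardson coefficients: $c^{\lambda}_{\mu,\nu}$ is the multiplicity of $V^\lambda$ in $V^\mu\otimes V^\nu$, where $V^\mu, V^\nu, V^\lambda$ are irreducible polynomial representations of $GL(N)$ ($N$ at least the number of parts of each partition involved). Equivalently (Littlewood-Richardson rule), $c^{\lambda}_{\mu,\nu}$ is the number of semistandard fillings (weakly increasing along rows, strictly increasing down columns) of the skew shape $\lambda/\mu$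 with content $\nu$ (exactly $\nu_i$ entries equal to $i$ for each $i$) such that the word obtained by reading the rows from top to bottom, each row from right to left, is a ballot word: in every initial segment, the number of $a$'s is at least the number of $b$'s whenever $a<b$. *)

theory Defs
  imports "HOL-Computational_Algebra.Polynomial" "HOL-Library.FuncSet"
begin

definition t_binomial :: "nat \<Rightarrow> nat \<Rightarrow> nat \<Rightarrow> int" where
  "t_binomial t n k = coeff ((\<Sum>i\<le>t. monom 1 i) ^ n) k"

text \<open>
  A partition is given by the weakly decreasing list of its parts. Rows and columns of
  Young diagrams are numbered from 0; the entries of a filling are positive integers, so
  that the letter \<open>Suc i\<close> is governed by the part with list index \<open>i\<close>.
\<close>

definition part :: "nat list \<Rightarrow> nat \<Rightarrow> nat" where
  "part p i = (if i < length p then p ! i else 0)"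

definition stretch :: "nat \<Rightarrow> nat list \<Rightarrow> nat list" where
  "stretch t p = map (\<lambda>x. t * x) p"

definition staircase :: "nat \<Rightarrow> nat list" where
  "staircase j = rev [1..<Suc j]"

definition skew_cells :: "nat list \<Rightarrow> nat list \<Rightarrow> (nat \<times> nat) set" where
  "skew_cells la mu = {(i, j). part mu i \<le> j \<and> j < part la i}"

definition semistandard :: "nat list \<Rightarrow> nat list \<Rightarrow> (nat \<times> nat \<Rightarrow> nat) \<Rightarrow> bool" where
  "semistandard la mu T \<longleftrightarrow>
     (\<forall>i j j'. (i, j) \<in> skew_cells la mu \<and> (i, j') \<in> skew_cells la mu \<and> j < j'
        \<longrightarrow> T (i, j) \<le> T (i, j')) \<and>
     (\<forall>i i' j. (i, j) \<in> skew_cells la mu \<and> (i', j) \<in> skew_cells la mu \<and> i < i'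
        \<longrightarrow> T (i, j) < T (i', j))"

definition has_content :: "nat list \<Rightarrow> nat list \<Rightarrow> nat list \<Rightarrow> (nat \<times> nat \<Rightarrow> nat) \<Rightarrow> bool" where
  "has_content la mu nu T \<longleftrightarrow>
     (\<forall>i. card {c \<in> skew_cells la mu. T c = Suc i} = part nu i)"

definition reading_word :: "nat list \<Rightarrow> nat list \<Rightarrow> (nat \<times> nat \<Rightarrow> nat) \<Rightarrow> nat list" where
  "reading_word la mu T =
     concat (map (\<lambda>i. map (\<lambda>j. T (i, j)) (rev [part mu i..<part la i])) [0..<length la])"

definition ballot :: "nat list \<Rightarrow> bool" where
  "ballot w \<longleftrightarrow>
     (\<forall>k a b. 1 \<le> a \<and> a < b \<longrightarrow> count_list (take k w) b \<le> count_list (take k w) a)"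

text \<open>
  Fillings are extensional functions on the cells of the skew shape, so that each filling
  is counted exactly once.
\<close>

definition LR_tableaux :: "nat list \<Rightarrow> nat list \<Rightarrow> nat list \<Rightarrow> (nat \<times> nat \<Rightarrow> nat) set" where
  "LR_tableaux la mu nu =
     {T \<in> skew_cells la mu \<rightarrow>\<^sub>E {1..}.
        semistandard la mu T \<and> has_content la mu nu T \<and> ballot (reading_word la mu T)}"

text \<open>
  The coefficient with upper index \<open>la\<close> and lower indices \<open>mu\<close>, \<open>nu\<close>, given by the
  Littlewood--Richardson rule; it vanishes when the diagram of \<open>mu\<close> is not contained
  in that of \<open>la\<close>.
\<close>

definition LR_coeff :: "nat list \<Rightarrow> nat list \<Rightarrow> nat list \<Rightarrow> nat" where
  "LR_coeff la mu nu =
     (if \<forall>i. part mu i \<le> part la i then card (LR_tableaux la mu nu) else 0)"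

text \<open>The set counted above is finite, so its cardinality is not the default value 0.\<close>

lemma finite_skew_cells: "finite (skew_cells la mu)"
proof (rule finite_subset)
  show "skew_cells la mu \<subseteq> (SIGMA i:{..<length la}. {..<part la i})"
    by (auto simp: skew_cells_def part_def split: if_splits)
qed auto

lemma finite_LR_tableaux: "finite (LR_tableaux la mu nu)"
proof (rule finite_subset)
  show "LR_tableaux la mu nu \<subseteq> skew_cells la mu \<rightarrow>\<^sub>E {..length nu}"
  proof
    fix T assume T: "T \<in> LR_tableaux la mu nu"
    have "T c \<le> length nu" if c: "c \<in> skew_cells la mu" for c
    proof (rule ccontr)
      assume big: "\<not> T c \<le> length nu"
      then obtain i where i: "T c = Suc i" "length nu \<le> i"
        by (cases "T c") auto
      have "card {c \<in> skew_cells la mu. T c = Suc i} = 0"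
        using T i(2) by (auto simp: LR_tableaux_def has_content_def part_def)
      then show False
        using c i(1) finite_skew_cells[of la mu] by (cases c) auto
    qed
    then show "T \<in> skew_cells la mu \<rightarrow>\<^sub>E {..length nu}"
      using T by (auto simp: LR_tableaux_def PiE_iff)
  qed
qed (auto intro: finite_PiE finite_skew_cells)

end

theory Submission
  imports Defs
begin

text \<open>
  The skew shape between consecutive stretched staircases consists of rows of length \<open>t\<close>, no
  two of which share a column. With entries 1 and 2 a semistandard filling is determined by
  the number \<open>a i\<close> of 2s in each row, and the ballot condition says that
  \<open>2 * (a 0 + \<dots> + a (i - 1)) + a i \<le> t * i\<close>. Adding a row gives a recursion for the number of
  such sequences with prescribed sum \<open>s\<close>. The difference of the t-binomial coefficients at
  \<open>s\<close> and \<open>s - 1\<close> obeys the same recursion, since it is antisymmetric under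
  \<open>s \<mapsto> t * n + 1 - s\<close>; in the middle degree a single term of the recursion survives, whence
  the first identity.
\<close>

section \<open>Differences of t-binomial coefficients\<close>

text \<open>Extension by zero to negative degrees, so that the recursion and the symmetry below hold
  for every integer without side conditions.\<close>

definition t_binomial_int :: "nat \<Rightarrow> nat \<Rightarrow> int \<Rightarrow> int" where
  "t_binomial_int t n k = (if k < 0 then 0 else t_binomial t n (nat k))"

lemma t_binomial_int_of_nat [simp]: "t_binomial_int t n (int k) = t_binomial t n k"
  by (simp add: t_binomial_int_def)

lemma t_binomial_int_0: "t_binomial_int t 0 k = (if k = 0 then 1 else 0)"
  by (auto simp: t_binomial_int_def t_binomial_def coeff_1)

lemma t_binomial_int_Suc:
  "t_binomial_int t (Suc n) k = (\<Sum>i\<le>t. t_binomial_int t n (k - int i))"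
proof (cases "k < 0")
  case False
  have "t_binomial t (Suc n) (nat k) =
      (\<Sum>i\<le>t. coeff (monom 1 i * (\<Sum>i\<le>t. monom 1 i) ^ n) (nat k))"
    by (simp add: t_binomial_def sum_distrib_right coeff_sum del: coeff_mult)
  also have "\<dots> = (\<Sum>i\<le>t. t_binomial_int t n (k - int i))"
    using False
    by (intro sum.cong refl)
      (auto simp: coeff_monom_mult t_binomial_int_def t_binomial_def nat_diff_distrib)
  finally show ?thesis
    using False by (simp add: t_binomial_int_def)
qed (simp add: t_binomial_int_def)

text \<open>The factor \<open>1 + x + ... + x^t\<close> is palindromic; in the induction this is the
  index reversal \<open>i \<mapsto> t - i\<close>.\<close>

lemma t_binomial_int_sym: "t_binomial_int t n (int (t * n) - k) = t_binomial_int t n k"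
proof (induction n arbitrary: k)
  case (Suc n)
  have "t_binomial_int t (Suc n) (int (t * Suc n) - k)
      = (\<Sum>i\<le>t. t_binomial_int t n (int (t * n) - (k - int (t - i))))"
    by (auto simp: t_binomial_int_Suc of_nat_diff algebra_simps intro!: sum.cong)
  also have "\<dots> = (\<Sum>i\<le>t. t_binomial_int t n (k - int (t - i)))"
    by (simp only: Suc.IH)
  also have "\<dots> = (\<Sum>i\<le>t. t_binomial_int t n (k - int i))"
    by (rule sum.reindex_bij_witness[of _ "\<lambda>i. t - i" "\<lambda>i. t - i"]) auto
  finally show ?case
    by (simp add: t_binomial_int_Suc)
qed (auto simp: t_binomial_int_0)

text \<open>The coefficient of \<open>x^s\<close> in \<open>(1 - x) * (1 + x + ... + x^t)^n\<close>,
  an antipalindromic polynomial of degree \<open>t * n + 1\<close>.\<close>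

definition t_binomial_diff :: "nat \<Rightarrow> nat \<Rightarrow> int \<Rightarrow> int" where
  "t_binomial_diff t n s = t_binomial_int t n s - t_binomial_int t n (s - 1)"

lemma t_binomial_diff_Suc:
  "t_binomial_diff t (Suc n) s = (\<Sum>x\<le>t. t_binomial_diff t n (s - int x))"
  by (simp add: t_binomial_diff_def t_binomial_int_Suc sum_subtractf algebra_simps)

lemma t_binomial_diff_antisym:
  "t_binomial_diff t n (int (t * n) + 1 - s) = - t_binomial_diff t n s"
  using t_binomial_int_sym[of t n s] t_binomial_int_sym[of t n "s - 1"]
  by (simp add: t_binomial_diff_def algebra_simps)

text \<open>Carries the count, obtained at a degree in the lower half, to the complementary degree
  used in the theorem.\<close>

lemma t_binomial_diff_complement:
  assumes "s \<le> t * n"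
  shows "t_binomial_diff t n (int s) = t_binomial t n (t * n - s) - t_binomial t n (t * n - s + 1)"
proof -
  have "int (t * n) - int s = int (t * n - s)" "int (t * n) - (int s - 1) = int (t * n - s + 1)"
    using assms by (simp_all add: of_nat_diff)
  with t_binomial_int_sym[of t n "int s"] t_binomial_int_sym[of t n "int s - 1"]
  show ?thesis
    by (metis t_binomial_diff_def t_binomial_int_of_nat)
qed

text \<open>
  The terms of \<open>t_binomial_diff_Suc\<close> omitted here, those with \<open>x < 2 * s - t * n\<close>, cancel in pairs under \<open>x \<mapsto> 2 * s - t * n - 1 - x\<close>.
\<close>

lemma t_binomial_diff_Suc_restricted:
  assumes "2 * s \<le> t * Suc n"
  shows "t_binomial_diff t (Suc n) (int s) =
    (\<Sum>x\<in>{x. x \<le> t \<and> 2 * s \<le> t * n + x}. t_binomial_diff t n (int s - int x))"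
proof -
  define N where "N = 2 * s - t * n"
  let ?g = "\<lambda>x. t_binomial_diff t n (int s - int x)"
  \<comment> \<open>The whole sum is compared with its own negative, so an odd \<open>N\<close>,
    whose middle index is fixed by the reflection, needs no separate case.\<close>
  have "(\<Sum>x<N. ?g x) = (\<Sum>x<N. - ?g x)"
  proof (rule sum.reindex_bij_witness[of _ "\<lambda>x. N - 1 - x" "\<lambda>x. N - 1 - x"])
    fix x assume "x \<in> {..<N}"
    then have "int s - int (N - 1 - x) = int (t * n) + 1 - (int s - int x)"
      by (auto simp: N_def)
    then show "- ?g (N - 1 - x) = ?g x"
      by (simp only: t_binomial_diff_antisym minus_minus)
  qed auto
  then have zero: "(\<Sum>x<N. ?g x) = 0"
    by (simp add: sum_negf)
  \<comment> \<open>The hypothesis gives \<open>N \<le> t\<close>, so the cancelling block lies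
    inside \<open>{..t}\<close>; for \<open>2 * s \<le> t * n\<close> truncated subtraction makes it
    empty.\<close>
  have split: "{..t} = {..<N} \<union> {x. x \<le> t \<and> 2 * s \<le> t * n + x}"
    using assms by (auto simp: N_def)
  have "(\<Sum>x\<le>t. ?g x) = (\<Sum>x<N. ?g x) + (\<Sum>x\<in>{x. x \<le> t \<and> 2 * s \<le> t * n + x}. ?g x)"
    unfolding split by (rule sum.union_disjoint) (auto simp: N_def)
  with zero show ?thesis
    by (simp add: t_binomial_diff_Suc)
qed

text \<open>The bound \<open>2 * s \<le> t * n + x\<close> now reads \<open>t \<le> x\<close>, which
  leaves only \<open>x = t\<close>.\<close>

lemma t_binomial_diff_middle:
  assumes "2 * s = t * Suc n"
  shows "t_binomial_diff t (Suc n) (int s) = t_binomial_diff t n (int s - int t)"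
proof -
  have "{x. x \<le> t \<and> 2 * s \<le> t * n + x} = {t}"
    using assms by auto
  then show ?thesis
    using t_binomial_diff_Suc_restricted[of s t n] assms by simp
qed

section \<open>Ballot words made of rows\<close>

lemma count_list_replicate [simp]: "count_list (replicate n x) y = (if x = y then n else 0)"
  by (induction n) auto

text \<open>Any other pair \<open>1 \<le> a < b\<close> has \<open>b \<ge> 3\<close>, a letter that
  does not occur.\<close>

lemma ballot_12:
  assumes "set w \<subseteq> {1, 2}"
  shows "ballot w \<longleftrightarrow> (\<forall>k. count_list (take k w) 2 \<le> count_list (take k w) 1)"
proof
  assume R: "\<forall>k. count_list (take k w) 2 \<le> count_list (take k w) 1"
  show "ballot w"
    unfolding ballot_def
  proof (intro allI impI)
    fix k a b :: nat assume ab: "1 \<le> a \<and> a < b"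
    show "count_list (take k w) b \<le> count_list (take k w) a"
    proof (cases "a = 1 \<and> b = 2")
      case False
      with ab have "b \<notin> {1, 2}" by auto
      then have "b \<notin> set (take k w)"
        using assms set_take_subset[of k w] by blast
      then show ?thesis by (simp add: count_notin)
    qed (use R in auto)
  qed
qed (auto simp: ballot_def)

lemma ballot_snoc:
  assumes "set w \<subseteq> {1, 2}" "c \<in> {1, 2}"
  shows "ballot (w @ [c]) \<longleftrightarrow>
    ballot w \<and> count_list (w @ [c]) 2 \<le> count_list (w @ [c]) 1"
proof -
  have take_snoc: "take k (w @ [c]) = (if k \<le> length w then take k w else w @ [c])" for k
    by (cases "k - length w") auto
  have "set (w @ [c]) \<subseteq> {1, 2}" using assms by auto
  then have "ballot (w @ [c]) \<longleftrightarrow>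
      (\<forall>k. count_list (take k (w @ [c])) 2 \<le> count_list (take k (w @ [c])) 1)"
    by (rule ballot_12)
  also have "\<dots> \<longleftrightarrow> (\<forall>k. count_list (take k w) 2 \<le> count_list (take k w) 1)
      \<and> count_list (w @ [c]) 2 \<le> count_list (w @ [c]) 1"
    (is "?L \<longleftrightarrow> ?A \<and> ?B")
  proof
    assume L: ?L
    have "count_list (take k w) 2 \<le> count_list (take k w) 1" for k
      \<comment> \<open>Cutting \<open>k\<close> at \<open>length w\<close> leaves
        \<open>take k w\<close> unchanged and keeps \<open>c\<close> out of the prefix of
        \<open>w @ [c]\<close>.\<close>
      using L[rule_format, of "min k (length w)"] by (simp add: take_snoc min_def split: if_splits)
    moreover have ?B
      using L[rule_format, of "Suc (length w)"] by simp
    ultimately show "?A \<and> ?B" by blast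
  next
    assume "?A \<and> ?B"
    then show ?L
      unfolding take_snoc by simp
  qed
  finally show ?thesis
    using ballot_12[OF assms(1)] by simp
qed

text \<open>Every appended 2 lowers the surplus of 1s by one, so the last prefix is the decisive
  one.\<close>

lemma ballot_append_2s:
  assumes "set w \<subseteq> {1, 2}"
  shows "ballot (w @ replicate x 2) \<longleftrightarrow>
    ballot w \<and> (x = 0 \<or> count_list w 2 + x \<le> count_list w 1)"
proof (induction x)
  case (Suc x)
  have "ballot (w @ replicate (Suc x) 2) \<longleftrightarrow> ballot ((w @ replicate x 2) @ [2])"
    by (simp add: replicate_append_same)
  also have "\<dots> \<longleftrightarrow> ballot (w @ replicate x 2) \<and> count_list w 2 + Suc x \<le> count_list w 1"
    using assms by (subst ballot_snoc) auto
  finally show ?case using Suc by auto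
qed simp

lemma ballot_append_1s:
  assumes "set w \<subseteq> {1, 2}"
  shows "ballot (w @ replicate x 1) \<longleftrightarrow> ballot w"
proof (induction x)
  case (Suc x)
  have "ballot (w @ replicate (Suc x) 1) \<longleftrightarrow> ballot ((w @ replicate x 1) @ [1])"
    by (simp add: replicate_append_same)
  also have "\<dots> \<longleftrightarrow> ballot (w @ replicate x 1)"
  proof -
    have "count_list w 2 \<le> count_list w 1" if "ballot (w @ replicate x 1)"
      using that Suc unfolding ballot_12[OF assms] by (metis take_all order_refl)
    then show ?thesis
      using assms by (subst ballot_snoc) auto
  qed
  finally show ?case using Suc by auto
qed simp

text \<open>\<open>a\<close> lists the numbers of 2s in the rows from top to bottom. Reading a
  weakly increasing row from right to left meets its 2s first.\<close>

definition row_word :: "nat \<Rightarrow> nat list \<Rightarrow> nat list" where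
  "row_word t a = concat (map (\<lambda>x. replicate x 2 @ replicate (t - x) 1) a)"

lemma set_row_word: "set (row_word t a) \<subseteq> {1, 2}"
  by (auto simp: row_word_def)

lemma count_row_word:
  assumes "set a \<subseteq> {..t}"
  shows "count_list (row_word t a) 2 = sum_list a"
    and "count_list (row_word t a) 1 + sum_list a = t * length a"
  using assms by (induction a) (auto simp: row_word_def)

text \<open>Within the new row the surplus of 1s is lowest right after the 2s, and before that row
  it equals \<open>t * length a - 2 * sum_list a\<close>.\<close>

lemma ballot_row_word_snoc:
  assumes "set a \<subseteq> {..t}"
  shows "ballot (row_word t (a @ [x])) \<longleftrightarrow>
    ballot (row_word t a) \<and> 2 * sum_list a + x \<le> t * length a"
proof -
  let ?w = "row_word t a"
  have "row_word t (a @ [x]) = (?w @ replicate x 2) @ replicate (t - x) 1"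
    by (simp add: row_word_def)
  moreover have "set (?w @ replicate x 2) \<subseteq> {1, 2}"
    using set_row_word[of t a] by auto
  ultimately have "ballot (row_word t (a @ [x])) \<longleftrightarrow> ballot (?w @ replicate x 2)"
    by (simp only: ballot_append_1s)
  \<comment> \<open>Covers \<open>x = 0\<close>, where \<open>ballot_append_2s\<close> supplies no
    inequality.\<close>
  moreover have "count_list ?w 2 \<le> count_list ?w 1" if "ballot ?w"
    using that unfolding ballot_12[OF set_row_word] by (metis take_all order_refl)
  ultimately show ?thesis
    using ballot_append_2s[OF set_row_word, of t a x] count_row_word[OF assms] by auto
qed

section \<open>Recursive enumeration of ballot sequences\<close>

definition ballot_seqs :: "nat \<Rightarrow> nat \<Rightarrow> nat \<Rightarrow> nat list set" where
  "ballot_seqs t n s =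
     {a. length a = n \<and> set a \<subseteq> {..t} \<and> sum_list a = s \<and> ballot (row_word t a)}"

lemma finite_ballot_seqs: "finite (ballot_seqs t n s)"
  by (rule finite_subset[OF _ finite_lists_length_eq[of "{..t}" n]])
    (auto simp: ballot_seqs_def)

lemma ballot_seqs_0: "ballot_seqs t 0 s = (if s = 0 then {[]} else {})"
  by (auto simp: ballot_seqs_def row_word_def ballot_def)

text \<open>Sequences are sorted by their last entry \<open>x\<close>: the ballot bound
  \<open>2 * (s - x) + x \<le> t * n\<close> becomes \<open>2 * s \<le> t * n + x\<close>, and
  \<open>x \<le> s\<close> guards the truncated subtraction.\<close>

lemma ballot_seqs_Suc:
  "ballot_seqs t (Suc n) s =
    (\<Union>x\<in>{x. x \<le> t \<and> x \<le> s \<and> 2 * s \<le> t * n + x}. (\<lambda>a. a @ [x]) ` ballot_seqs t n (s - x))"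
  (is "?L = ?R")
proof (intro equalityI subsetI)
  fix b assume b: "b \<in> ?L"
  then obtain a x where "b = a @ [x]"
    by (metis (mono_tags, lifting) ballot_seqs_def length_Suc_conv_rev mem_Collect_eq)
  then show "b \<in> ?R"
    using b ballot_row_word_snoc[of a t x] by (force simp: ballot_seqs_def)
next
  fix b assume "b \<in> ?R"
  then obtain a x where "b = a @ [x]" "x \<le> t" "x \<le> s" "2 * s \<le> t * n + x"
      "a \<in> ballot_seqs t n (s - x)"
    by blast
  then show "b \<in> ?L"
    using ballot_row_word_snoc[of a t x] by (auto simp: ballot_seqs_def)
qed

text \<open>Both sides obey the recursion of \<open>t_binomial_diff_Suc_restricted\<close>. The
  identity is confined to the lower half of the degrees, since the difference is antisymmetric about
  the middle while a cardinality is nonnegative.\<close>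

lemma card_ballot_seqs:
  "2 * s \<le> t * n \<Longrightarrow> int (card (ballot_seqs t n s)) = t_binomial_diff t n (int s)"
proof (induction n arbitrary: s)
  case 0
  then show ?case
    by (simp add: ballot_seqs_0 t_binomial_diff_def t_binomial_int_0)
next
  case (Suc n)
  let ?X = "{x. x \<le> t \<and> x \<le> s \<and> 2 * s \<le> t * n + x}"
  have "card (ballot_seqs t (Suc n) s) = (\<Sum>x\<in>?X. card ((\<lambda>a. a @ [x]) ` ballot_seqs t n (s - x)))"
    unfolding ballot_seqs_Suc
    by (rule card_UN_disjoint) (auto simp: finite_ballot_seqs)
  also have "\<dots> = (\<Sum>x\<in>?X. card (ballot_seqs t n (s - x)))"
    by (intro sum.cong refl card_image) (auto simp: inj_on_def)
  finally have "int (card (ballot_seqs t (Suc n) s)) =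
      (\<Sum>x\<in>?X. int (card (ballot_seqs t n (s - x))))"
    by simp
  also have "\<dots> = (\<Sum>x\<in>?X. t_binomial_diff t n (int s - int x))"
  proof (rule sum.cong)
    fix x assume x: "x \<in> ?X"
    \<comment> \<open>The degree stays in the lower half for \<open>n\<close>, because
      \<open>2 * s \<le> t * n + x \<le> t * n + 2 * x\<close>.\<close>
    then have "2 * (s - x) \<le> t * n" by auto
    from Suc.IH[OF this] show "int (card (ballot_seqs t n (s - x))) = t_binomial_diff t n (int s - int x)"
      using x by (simp add: of_nat_diff)
  qed simp
  also have "\<dots> = (\<Sum>x\<in>{x. x \<le> t \<and> 2 * s \<le> t * n + x}. t_binomial_diff t n (int s - int x))"
    by (rule sum.mono_neutral_left) (auto simp: t_binomial_diff_def t_binomial_int_def)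
  also have "\<dots> = t_binomial_diff t (Suc n) (int s)"
    by (rule t_binomial_diff_Suc_restricted[symmetric]) (fact Suc.prems)
  finally show ?case .
qed

section \<open>Fillings of a stretched staircase strip\<close>

text \<open>Truncated subtraction yields 0 for rows past the last, so one formula serves every
  \<open>i\<close>.\<close>

lemma part_stretch_staircase: "part (stretch t (staircase n)) i = t * (n - i)"
  by (auto simp: part_def stretch_def staircase_def rev_nth Suc_diff_Suc
      simp del: upt_Suc mult_Suc_right)

lemma length_stretch_staircase: "length (stretch t (staircase n)) = n"
  by (simp add: stretch_def staircase_def)

lemma skew_cells_staircase:
  "skew_cells (stretch t (staircase (Suc n))) (stretch t (staircase n)) =
    (SIGMA i:{..n}. {t * (n - i)..<t * (n - i) + t})"
proof -
  have "t * (Suc n - i) = (if i \<le> n then t * (n - i) + t else 0)" for i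
    by (auto simp: Suc_diff_le)
  then show ?thesis
    by (auto simp: skew_cells_def part_stretch_staircase split: if_splits)
qed

text \<open>A lower row stops at or before the column where a higher one starts. This makes the
  column condition on fillings vacuous.\<close>

lemma staircase_columns_disjoint:
  fixes t n :: nat
  assumes "j \<in> {t * (n - i)..<t * (n - i) + t}" "j \<in> {t * (n - i')..<t * (n - i') + t}"
    and "i < i'" "i' \<le> n"
  shows False
proof -
  have "t * Suc (n - i') \<le> t * (n - i)"
    using assms by (intro mult_le_mono2) auto
  then show False using assms by auto
qed

text \<open>Weak increase forces the 1s to stand left of the 2s. Restriction to the cells gives the
  extensional function that \<open>LR_tableaux\<close> asks for.\<close>

definition row_filling :: "nat \<Rightarrow> nat \<Rightarrow> nat list \<Rightarrow> nat \<times> nat \<Rightarrow> nat" where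
  "row_filling t n a = (\<lambda>(i, j)\<in>(SIGMA i:{..n}. {t * (n - i)..<t * (n - i) + t}).
     if j < t * (n - i) + (t - a ! i) then 1 else 2)"

lemma row_filling_apply:
  "i \<le> n \<Longrightarrow> t * (n - i) \<le> j \<Longrightarrow> j < t * (n - i) + t \<Longrightarrow>
    row_filling t n a (i, j) = (if j < t * (n - i) + (t - a ! i) then 1 else 2)"
  by (simp add: row_filling_def)

lemma nth_le_of_set_le:
  fixes t n :: nat
  assumes "length a = Suc n" "set a \<subseteq> {..t}" "i \<le> n"
  shows "a ! i \<le> t"
proof -
  have "a ! i \<in> set a" using assms by simp
  then show ?thesis using assms(2) by blast
qed

lemma card_row_filling_2:
  assumes "length a = Suc n" "set a \<subseteq> {..t}"
  shows "card {c \<in> (SIGMA i:{..n}. {t * (n - i)..<t * (n - i) + t}). row_filling t n a c = 2}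
    = sum_list a" (is "card ?C = _")
proof -
  have le: "a ! i \<le> t" if "i \<le> n" for i
    using nth_le_of_set_le[OF assms that] .
  have "?C = (SIGMA i:{..n}. {t * (n - i) + (t - a ! i)..<t * (n - i) + t})"
    by (auto simp: row_filling_def split: if_splits)
  then have "card ?C = (\<Sum>i\<le>n. card {t * (n - i) + (t - a ! i)..<t * (n - i) + t})"
    by (simp add: card_SigmaI)
  also have "\<dots> = (\<Sum>i\<le>n. a ! i)"
  proof (rule sum.cong)
    fix i assume "i \<in> {..n}"
    then show "card {t * (n - i) + (t - a ! i)..<t * (n - i) + t} = a ! i"
      using le[of i] by simp
  qed simp
  also have "\<dots> = sum_list a"
    using assms by (simp add: sum_list_sum_nth atLeast0LessThan lessThan_Suc_atMost)
  finally show ?thesis .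
qed

lemma card_row_filling_1:
  assumes "length a = Suc n" "set a \<subseteq> {..t}"
  shows "card {c \<in> (SIGMA i:{..n}. {t * (n - i)..<t * (n - i) + t}). row_filling t n a c = 1}
    + sum_list a = t * Suc n" (is "card ?C1 + _ = _")
proof -
  let ?S = "SIGMA i:{..n}. {t * (n - i)..<t * (n - i) + t}"
  let ?C2 = "{c \<in> ?S. row_filling t n a c = 2}"
  have "?C1 \<union> ?C2 = ?S"
    by (auto simp: row_filling_def split: if_splits)
  moreover have "card (?C1 \<union> ?C2) = card ?C1 + card ?C2"
    by (rule card_Un_disjoint) auto
  moreover have "card ?S = t * Suc n"
    by (simp add: card_SigmaI)
  ultimately show ?thesis
    using card_row_filling_2[OF assms] by simp
qed

lemma reading_word_row_filling:
  assumes "length a = Suc n" "set a \<subseteq> {..t}"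
  shows "reading_word (stretch t (staircase (Suc n))) (stretch t (staircase n)) (row_filling t n a)
    = row_word t a"
proof -
  have row: "map (\<lambda>j. row_filling t n a (i, j)) (rev [t * (n - i)..<t * (Suc n - i)])
      = replicate (a ! i) 2 @ replicate (t - a ! i) 1" if "i < Suc n" for i
  proof -
    have le: "a ! i \<le> t" using nth_le_of_set_le[OF assms] that by simp
    have len: "t * (Suc n - i) = t * (n - i) + t"
      using that by (simp add: Suc_diff_le)
    show ?thesis
      unfolding len using that le
      by (intro nth_equalityI) (auto simp: rev_nth nth_append row_filling_apply)
  qed
  have "reading_word (stretch t (staircase (Suc n))) (stretch t (staircase n)) (row_filling t n a)
      = concat (map (\<lambda>i. replicate (a ! i) 2 @ replicate (t - a ! i) 1) [0..<Suc n])"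
    unfolding reading_word_def part_stretch_staircase length_stretch_staircase
    by (intro arg_cong[of _ _ concat] map_cong refl row) auto
  also have "\<dots> = row_word t a"
    unfolding row_word_def
    by (intro arg_cong[of _ _ concat] nth_equalityI) (simp_all add: assms del: upt_Suc)
  finally show ?thesis .
qed

text \<open>Semistandardness is automatic, so only the content and the ballot condition remain. By
  \<open>p + q = Suc n\<close> the content fills all \<open>t * Suc n\<close> cells, so the number
  of 1s is right once that of the 2s is.\<close>

lemma row_filling_in_LR_tableaux:
  assumes a: "length a = Suc n" "set a \<subseteq> {..t}" and pq: "p + q = Suc n"
  shows "row_filling t n a \<in> LR_tableaux (stretch t (staircase (Suc n))) (stretch t (staircase n))
      (stretch t [p, q]) \<longleftrightarrow> sum_list a = t * q \<and> ballot (row_word t a)"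
proof -
  let ?T = "row_filling t n a"
  let ?la = "stretch t (staircase (Suc n))" and ?mu = "stretch t (staircase n)"
  have "?T \<in> skew_cells ?la ?mu \<rightarrow>\<^sub>E {1..}"
    unfolding skew_cells_staircase by (auto simp: row_filling_def)
  moreover have "semistandard ?la ?mu ?T"
    unfolding semistandard_def skew_cells_staircase
  proof (intro conjI allI impI; elim conjE SigmaE2)
    fix i i' j
    assume "i < i'" "i' \<in> {..n}" "j \<in> {t * (n - i)..<t * (n - i) + t}"
      "j \<in> {t * (n - i')..<t * (n - i') + t}"
    then show "?T (i, j) < ?T (i', j)"
      using staircase_columns_disjoint[of j t n i i'] by simp
  qed (auto simp: row_filling_apply)
  moreover have "has_content ?la ?mu (stretch t [p, q]) ?T \<longleftrightarrow> sum_list a = t * q"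
  proof
    assume "has_content ?la ?mu (stretch t [p, q]) ?T"
    then have "card {c \<in> skew_cells ?la ?mu. ?T c = Suc 1} = part (stretch t [p, q]) 1"
      unfolding has_content_def by blast
    then show "sum_list a = t * q"
      unfolding skew_cells_staircase
      by (simp add: card_row_filling_2[OF a] part_def stretch_def flip: numeral_2_eq_2)
  next
    assume s: "sum_list a = t * q"
    show "has_content ?la ?mu (stretch t [p, q]) ?T"
      unfolding has_content_def
    proof
      fix i :: nat
      consider "i = 0" | "i = 1" | "i \<ge> 2" by linarith
      then show "card {c \<in> skew_cells ?la ?mu. ?T c = Suc i} = part (stretch t [p, q]) i"
      proof cases
        case 1
        have "t * Suc n = t * p + t * q"
          using pq by (metis add_mult_distrib2)
        with 1 show ?thesis
          using card_row_filling_1[OF a] s unfolding skew_cells_staircase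
          by (simp add: part_def) (simp add: stretch_def)
      next
        case 2
        then show ?thesis
          using card_row_filling_2[OF a] s unfolding skew_cells_staircase
          by (simp add: part_def flip: numeral_2_eq_2) (simp add: stretch_def)
      next
        case 3
        then have "{c \<in> skew_cells ?la ?mu. ?T c = Suc i} = {}"
          unfolding skew_cells_staircase by (auto simp: row_filling_def)
        moreover have "part (stretch t [p, q]) i = 0"
          using 3 by (simp add: part_def stretch_def)
        ultimately show ?thesis
          by (simp only: card.empty)
      qed
    qed
  qed
  ultimately show ?thesis
    by (simp add: LR_tableaux_def reading_word_row_filling[OF a])
qed

text \<open>A content with two parts admits only the letters 1 and 2. By weak increase the 1s of
  each row form an initial segment, whose length determines the row.\<close>

lemma LR_tableau_is_row_filling:
  assumes T: "T \<in> LR_tableaux (stretch t (staircase (Suc n))) (stretch t (staircase n))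
      (stretch t [p, q])"
  obtains a where "length a = Suc n" "set a \<subseteq> {..t}" "T = row_filling t n a"
proof -
  let ?la = "stretch t (staircase (Suc n))" and ?mu = "stretch t (staircase n)"
  let ?S = "SIGMA i:{..n}. {t * (n - i)..<t * (n - i) + t}"
  have ext: "T \<in> ?S \<rightarrow>\<^sub>E {1..}"
    and row: "\<And>i j j'. (i, j) \<in> ?S \<Longrightarrow> (i, j') \<in> ?S \<Longrightarrow> j < j' \<Longrightarrow> T (i, j) \<le> T (i, j')"
    and content: "\<And>i. card {c \<in> ?S. T c = Suc i} = part (stretch t [p, q]) i"
    using T unfolding LR_tableaux_def semistandard_def has_content_def skew_cells_staircase
    by blast+
  have vals: "T c = 1 \<or> T c = 2" if c: "c \<in> ?S" for c
  proof (rule ccontr)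
    assume neq: "\<not> (T c = 1 \<or> T c = 2)"
    have "T c \<ge> 1" using ext c by fastforce
    with neq obtain i where i: "T c = Suc i" "i \<ge> 2"
      by (cases "T c") auto
    have "card {c \<in> ?S. T c = Suc i} = 0"
      using content[of i] i(2) by (simp add: part_def stretch_def)
    \<comment> \<open>Finiteness is what turns cardinality 0 into emptiness, as \<open>card\<close>
      is also 0 on infinite sets.\<close>
    moreover have "finite {c \<in> ?S. T c = Suc i}" by auto
    ultimately have "{c \<in> ?S. T c = Suc i} = {}" by simp
    then show False using c i(1) by blast
  qed
  define J where "J i = {j \<in> {t * (n - i)..<t * (n - i) + t}. T (i, j) = 1}" for i
  define a where "a = map (\<lambda>i. t - card (J i)) [0..<Suc n]"
  have J: "J i = {t * (n - i)..<t * (n - i) + card (J i)}" "card (J i) \<le> t" if "i \<le> n" for i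
  proof -
    have fin: "finite (J i)" by (simp add: J_def)
    \<comment> \<open>To the left of a 1 in the same row only 1s can stand, so a nonempty
      \<open>J i\<close> is an interval beginning at the first cell of the row.\<close>
    have down: "j' \<in> J i" if "j \<in> J i" "t * (n - i) \<le> j'" "j' \<le> j" for j j'
      using that row[of i j' j] vals[of "(i, j')"] \<open>i \<le> n\<close>
      by (cases "j' = j") (auto simp: J_def)
    have "card (J i) \<le> card {t * (n - i)..<t * (n - i) + t}"
      by (rule card_mono) (auto simp: J_def)
    then show "card (J i) \<le> t" by simp
    show "J i = {t * (n - i)..<t * (n - i) + card (J i)}"
    proof (cases "J i = {}")
      case False
      obtain M where M: "M \<in> J i" "\<And>j. j \<in> J i \<Longrightarrow> j \<le> M"
        using False fin Max_in Max_ge by metis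
      have l: "t * (n - i) \<le> j" if "j \<in> J i" for j
        using that by (simp add: J_def)
      have eq: "J i = {t * (n - i)..<Suc M}"
        using l M(2) down[OF M(1)] by (auto simp: less_Suc_eq_le)
      then have "card (J i) = Suc M - t * (n - i)"
        by simp
      with eq l[OF M(1)] show ?thesis by simp
    qed simp
  qed
  have nth_a: "a ! i = t - card (J i)" if "i \<le> n" for i
    using that by (simp add: a_def nth_map_upt del: upt_Suc)
  have "T = row_filling t n a"
  proof
    fix c :: "nat \<times> nat"
    obtain i j where c: "c = (i, j)" by force
    show "T c = row_filling t n a c"
    proof (cases "c \<in> ?S")
      case True
      then have ij: "i \<le> n" "t * (n - i) \<le> j" "j < t * (n - i) + t"
        by (auto simp: c)
      have "T (i, j) = 1 \<longleftrightarrow> j \<in> J i"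
        using ij by (simp add: J_def)
      also have "\<dots> \<longleftrightarrow> j < t * (n - i) + card (J i)"
        using ij(2) by (subst J(1)[OF ij(1)]) simp
      finally have "T (i, j) = 1 \<longleftrightarrow> j < t * (n - i) + (t - a ! i)"
        using nth_a[OF ij(1)] J(2)[OF ij(1)] by simp
      then show ?thesis
        using vals[OF True] ij by (auto simp: c row_filling_apply)
    next
      case False
      then show ?thesis
        using ext by (auto simp: row_filling_def restrict_def)
    qed
  qed
  moreover have "length a = Suc n" "set a \<subseteq> {..t}"
    by (auto simp: a_def)
  ultimately show ?thesis
    using that by blast
qed

lemma inj_on_row_filling: "inj_on (row_filling t n) {a. length a = Suc n \<and> set a \<subseteq> {..t}}"
proof (rule inj_onI)
  fix a b
  assume a: "a \<in> {a. length a = Suc n \<and> set a \<subseteq> {..t}}"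
    and b: "b \<in> {a. length a = Suc n \<and> set a \<subseteq> {..t}}"
    and eq: "row_filling t n a = row_filling t n b"
  have "a ! i \<ge> b ! i" if i: "i < Suc n" and eq: "row_filling t n a = row_filling t n b"
    and b: "b ! i \<le> t" for a b i
  proof (rule ccontr)
    assume "\<not> b ! i \<le> a ! i"
    \<comment> \<open>This column holds the leftmost 2 of row \<open>i\<close> for \<open>b\<close>;
      the filling for \<open>a\<close>, with fewer 2s in that row, still has a 1 there.\<close>
    with b have "row_filling t n a (i, t * (n - i) + (t - b ! i)) = 1"
      "row_filling t n b (i, t * (n - i) + (t - b ! i)) = 2"
      using i by (auto simp: row_filling_apply)
    with eq show False by simp
  qed
  note ge = this
  have "a ! i = b ! i" if "i < Suc n" for i
    using ge[of i a b] ge[of i b a] that eq a b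
      nth_le_of_set_le[of a n t i] nth_le_of_set_le[of b n t i] by simp
  then show "a = b"
    using a b by (auto intro: nth_equalityI)
qed

section \<open>Littlewood-Richardson coefficients of stretched staircases\<close>

lemma LR_coeff_staircase:
  assumes pq: "p + q = Suc n"
  shows "LR_coeff (stretch t (staircase (Suc n))) (stretch t (staircase n)) (stretch t [p, q])
    = card (ballot_seqs t (Suc n) (t * q))"
proof -
  have "LR_tableaux (stretch t (staircase (Suc n))) (stretch t (staircase n)) (stretch t [p, q])
      = row_filling t n ` ballot_seqs t (Suc n) (t * q)" (is "?L = ?R")
  proof (intro equalityI subsetI)
    fix T assume T: "T \<in> ?L"
    obtain a where a: "length a = Suc n" "set a \<subseteq> {..t}" "T = row_filling t n a"
      by (rule LR_tableau_is_row_filling[OF T])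
    then show "T \<in> ?R"
      using T row_filling_in_LR_tableaux[OF a(1,2) pq] by (simp add: ballot_seqs_def)
  next
    fix T assume "T \<in> ?R"
    then show "T \<in> ?L"
      using row_filling_in_LR_tableaux[OF _ _ pq] by (auto simp: ballot_seqs_def)
  qed
  moreover have "inj_on (row_filling t n) (ballot_seqs t (Suc n) (t * q))"
    by (rule inj_on_subset[OF inj_on_row_filling]) (auto simp: ballot_seqs_def)
  \<comment> \<open>The inner diagram is contained in the outer one, which selects the counting
    branch of \<open>LR_coeff\<close>.\<close>
  moreover have "t * (n - i) \<le> t * (Suc n - i)" for i
    by (intro mult_le_mono2) simp
  ultimately show ?thesis
    by (simp add: LR_coeff_def part_stretch_staircase card_image)
qed

lemma LR_coeff_staircase_t_binomial:
  assumes "p + q = Suc n" "q \<le> p"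
  shows "int (LR_coeff (stretch t (staircase (Suc n))) (stretch t (staircase n)) (stretch t [p, q]))
    = t_binomial_diff t (Suc n) (int (t * q))"
proof -
  \<comment> \<open>From \<open>q \<le> p\<close> follows \<open>2 * q \<le> p + q\<close>, so the
    degree \<open>t * q\<close> lies in the lower half.\<close>
  have "t * (2 * q) \<le> t * Suc n"
    using assms by (intro mult_le_mono2) simp
  then show ?thesis
    using LR_coeff_staircase[OF assms(1), of t] card_ballot_seqs[of "t * q" t "Suc n"] by simp
qed

theorem theorem4:
  fixes t m :: nat
  assumes "t \<ge> 1" and "m \<ge> 1"
  shows "t_binomial t (2 * m + 1) (t * (m + 1)) - t_binomial t (2 * m + 1) (t * (m + 1) + 1)
           = t_binomial t (2 * m + 2) (t * (m + 1)) - t_binomial t (2 * m + 2) (t * (m + 1) + 1)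
         \<and> LR_coeff (stretch t (staircase (2 * m + 1))) (stretch t (staircase (2 * m)))
             (stretch t [m + 1, m])
           = LR_coeff (stretch t (staircase (2 * m + 2))) (stretch t (staircase (2 * m + 1)))
             (stretch t [m + 1, m + 1])
         \<and> t_binomial t (2 * m + 1) (t * (m + 1)) - t_binomial t (2 * m + 1) (t * (m + 1) + 1)
           = int (LR_coeff (stretch t (staircase (2 * m + 1))) (stretch t (staircase (2 * m)))
                   (stretch t [m + 1, m]))
         \<and> t_binomial t (2 * m + 2) (t * (m + 1)) - t_binomial t (2 * m + 2) (t * (m + 1) + 1)
           = int (LR_coeff (stretch t (staircase (2 * m + 2))) (stretch t (staircase (2 * m + 1)))
                   (stretch t [m + 1, m + 1]))"
proof -
  let ?D = t_binomial_diff
  \<comment> \<open>The degrees \<open>t * m\<close> and \<open>t * (m + 1)\<close> add up to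
    \<open>t * (2 * m + 1)\<close>.\<close>
  have odd: "?D t (2 * m + 1) (int (t * m)) =
      t_binomial t (2 * m + 1) (t * (m + 1)) - t_binomial t (2 * m + 1) (t * (m + 1) + 1)"
    using t_binomial_diff_complement[of "t * m" t "2 * m + 1"]
    by (simp add: algebra_simps flip: diff_mult_distrib2)
  have even: "?D t (2 * m + 2) (int (t * (m + 1))) =
      t_binomial t (2 * m + 2) (t * (m + 1)) - t_binomial t (2 * m + 2) (t * (m + 1) + 1)"
    using t_binomial_diff_complement[of "t * (m + 1)" t "2 * m + 2"]
    by (simp add: algebra_simps flip: diff_mult_distrib2)
  \<comment> \<open>For \<open>2 * m + 2\<close> factors \<open>t * (m + 1)\<close> is the exact
    middle degree; the surviving term \<open>x = t\<close> lowers it to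
    \<open>t * m\<close>.\<close>
  have eq: "?D t (2 * m + 2) (int (t * (m + 1))) = ?D t (2 * m + 1) (int (t * m))"
    using t_binomial_diff_middle[of "t * (m + 1)" t "2 * m + 1"]
    by (simp add: algebra_simps)
  note LR_odd = LR_coeff_staircase_t_binomial[of "m + 1" m "2 * m" t]
  note LR_even = LR_coeff_staircase_t_binomial[of "m + 1" "m + 1" "2 * m + 1" t]
  show ?thesis
    using odd even eq LR_odd LR_even by simp
qed

end
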